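(* Let $\mathfrak{Q}$ be a set-valued map assigning to each market model $S\in\mathcal{S}$ a subset $\mathfrak{Q}(S)\subseteq\mathfrak{P}_c(\Omega)$, and suppose that $\mathfrak{Q}$ is $\lhd$-monotone and weakly $\operatorname{NA}$-preserving. Suppose that $S\in\mathcal{S}$ satisfies $\operatorname{NA}(\mathcal{P},S)$. Then $\pi(\,\cdot\mid S)$ is $\mathcal{P}$-sensitive with reduction set $\mathfrak{Q}(S)$ and $(\pi^Q(\,\cdot\mid S))_{Q\in\mathfrak{Q}(S)}$ is a $\mathfrak{Q}(S)$-localization of $\pi(\,\cdot\mid S)$. In particular, for all $X\in L^\infty_c$, $$\pi(X\mid S)=\sup_{Q\in\mathfrak{Q}(S)}\pi^Q_E(X\mid S)=\sup_{Q\in\mathfrak{Q}(S)}\pi^Q(X\mid S).$$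
   Context: $(\Omega,\mathcal{F})$ is a measurable space and $\mathcal{P}$ is a non-empty set of probability measures on it; $c(A):=\sup_{P\in\mathcal{P}}P(A)$ for $A\in\mathcal{F}$. An event $A\in\mathcal{F}$ is $\mathcal{P}$-polar if $c(A)=0$; a property holds $\mathcal{P}$-q.s. if it holds outside a $\mathcal{P}$-polar event. $\mathfrak{P}_c(\Omega)$ is the set of probability measures on $(\Omega,\mathcal{F})$ vanishing on all $\mathcal{P}$-polar events. $L^0_c$ is the space of equivalence classes $[x]_c$ of real-valued random variables up to $\mathcal{P}$-q.s. equality, with order $X\preccurlyeq Y$ iff $x\le y$ $\mathcal{P}$-q.s. for representatives; constants are identified with the classes they induce; $L^\infty_c:=\{X\in L^0_c\mid\exists m>0\colon|X|\preccurlyeq m\}$. For $Q\in\mathfrak{P}_c(\Omega)$, $\le_Q$ is the $Q$-a.s. order and $j_Q([x]_c):=[x]_Q$, where $[x]_Q$ is the class of $x$ modulo $Q$-a.s. equality. Markets: a one-period market model of dimension $d\in\mathbb{N}$ is $S=(S_0,S_1)$ with $S_0\in\mathbb{R}^d$ and $S_1$ a bounded $d$-dimensional random vector on $(\Omega,\mathcal{F})$, all coordinates of $S_0,S_1$ being non-negative; $\mathcal{S}$ is the collection of all such models of all dimensions $d\in\mathbb{N}$; $d(S)$ is the dimension of $S$; $\Delta S:=S_1-S_0$; for $H\in\mathbb{R}^{d(S)}$, $H\Delta S$ is the ($\omega$-wise) Euclidean scalar product. $S\lhd S'$ means that for every $i\in\{1,\dots,d(S)\}$ there is $j\in\{1,\dots,d(S')\}$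 with $(S^i_0,S^i_1)=(S'^j_0,S'^j_1)$. $\operatorname{NA}(\mathcal{P},S)$ holds if for all $H\in\mathbb{R}^{d(S)}$, $H\Delta S\ge0$ $\mathcal{P}$-q.s. implies $H\Delta S=0$ $\mathcal{P}$-q.s. For $Q\in\mathfrak{P}_c(\Omega)$, $\operatorname{NA}(Q,S)$ holds if for all $H\in\mathbb{R}^{d(S)}$, $H\Delta S\ge0$ $Q$-a.s. implies $H\Delta S=0$ $Q$-a.s. $\mathfrak{Q}$ is $\lhd$-monotone if $\mathfrak{Q}(S')\subseteq\mathfrak{Q}(S)$ for all $S,S'\in\mathcal{S}$ with $S\lhd S'$. $\mathfrak{Q}$ is weakly $\operatorname{NA}$-preserving if for any $S\in\mathcal{S}$ satisfying $\operatorname{NA}(\mathcal{P},S)$ there exists $Q\in\mathfrak{Q}(S)$ such that $\operatorname{NA}(Q,S)$ holds. Superhedging functionals, for $X\in L^\infty_c$: $\pi(X\mid S):=\inf\{r\in\mathbb{R}\mid\exists H\in\mathbb{R}^{d(S)}\colon X\preccurlyeq r+[H\Delta S]_c\}$ and $\pi^Q(X\mid S):=\inf\{r\in\mathbb{R}\mid\exists H\in\mathbb{R}^{d(S)}\colon X\le_Q r+[H\Delta S]_c\}$. Moreover $\pi^Q_E(X\mid S):=\inf\{r\in\mathbb{R}\mid j_Q(X)\in j_Q(\{Y\in L^\infty_c\mid\pi(Y\mid S)\le r\})\}\in[-\infty,\infty]$. Sensitivity (with domain $L^\infty_c$): a function $f\colon L^\infty_c\to[-\infty,\infty]$ is $\mathcal{P}$-sensitive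 if each level set $E_r:=\{X\in L^\infty_c\mid f(X)\le r\}$, $r\in\mathbb{R}$, is empty or satisfies, for all $X\in L^\infty_c$, $X\in E_r\Leftrightarrow\forall Q\in\mathfrak{P}_c(\Omega)\colon j_Q(X)\in j_Q(E_r)$. A non-empty $\mathcal{Q}\subseteq\mathfrak{P}_c(\Omega)$ is a reduction set for $f$ if for all $r\in\mathbb{R}$ and $X\in L^\infty_c$: $X\in E_r\Leftrightarrow\forall Q\in\mathcal{Q}\colon j_Q(X)\in j_Q(E_r)$. A $\mathcal{Q}$-localization of $f$ is a family $(f^Q)_{Q\in\mathcal{Q}}$ of functions $L^\infty_c\to[-\infty,\infty]$ such that $j_Q(X)=j_Q(Y)$ implies $f^Q(X)=f^Q(Y)$ for each $Q\in\mathcal{Q}$, and $f=\sup_{Q\in\mathcal{Q}}f^Q$ pointwise. *)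

theory Defs
  imports "HOL-Probability.Probability"
begin

section \<open>Quasi-sure analysis\<close>

definition prob_measures :: "'a measure \<Rightarrow> 'a measure set" where
  "prob_measures M = {Q. prob_space Q \<and> sets Q = sets M}"

definition capacity :: "'a measure set \<Rightarrow> 'a set \<Rightarrow> ennreal" where
  "capacity \<P> A = (SUP P\<in>\<P>. emeasure P A)"

definition polar :: "'a measure \<Rightarrow> 'a measure set \<Rightarrow> 'a set \<Rightarrow> bool" where
  "polar M \<P> A \<longleftrightarrow> A \<in> sets M \<and> capacity \<P> A = 0"

definition quasi_surely :: "'a measure \<Rightarrow> 'a measure set \<Rightarrow> ('a \<Rightarrow> bool) \<Rightarrow> bool" where
  "quasi_surely M \<P> \<phi> \<longleftrightarrow> (\<exists>N. polar M \<P> N \<and> (\<forall>\<omega>\<in>space M - N. \<phi> \<omega>))"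

definition polar_null_measures :: "'a measure \<Rightarrow> 'a measure set \<Rightarrow> 'a measure set" where
  "polar_null_measures M \<P> =
     {Q \<in> prob_measures M. \<forall>A. polar M \<P> A \<longrightarrow> emeasure Q A = 0}"

text \<open>Random variables are total functions on the type \<^typ>\<open>'a\<close>; their values outside
  \<open>space M\<close> are irrelevant, since both equivalence relations below ignore them.\<close>

definition qs_eq :: "'a measure \<Rightarrow> 'a measure set \<Rightarrow> (('a \<Rightarrow> real) \<times> ('a \<Rightarrow> real)) set" where
  "qs_eq M \<P> = {(x, y). x \<in> borel_measurable M \<and> y \<in> borel_measurable M \<and>
                        quasi_surely M \<P> (\<lambda>\<omega>. x \<omega> = y \<omega>)}"

definition as_eq :: "'a measure \<Rightarrow> 'a measure \<Rightarrow> (('a \<Rightarrow> real) \<times> ('a \<Rightarrow> real)) set" where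
  "as_eq M Q = {(x, y). x \<in> borel_measurable M \<and> y \<in> borel_measurable M \<and>
                        (AE \<omega> in Q. x \<omega> = y \<omega>)}"

definition qs_class :: "'a measure \<Rightarrow> 'a measure set \<Rightarrow> ('a \<Rightarrow> real) \<Rightarrow> ('a \<Rightarrow> real) set" where
  "qs_class M \<P> x = qs_eq M \<P> `` {x}"

definition L0 :: "'a measure \<Rightarrow> 'a measure set \<Rightarrow> ('a \<Rightarrow> real) set set" where
  "L0 M \<P> = borel_measurable M // qs_eq M \<P>"

definition qs_le :: "'a measure \<Rightarrow> 'a measure set \<Rightarrow> ('a \<Rightarrow> real) set \<Rightarrow> ('a \<Rightarrow> real) set \<Rightarrow> bool" where
  "qs_le M \<P> X Y \<longleftrightarrow> (\<exists>x\<in>X. \<exists>y\<in>Y. quasi_surely M \<P> (\<lambda>\<omega>. x \<omega> \<le> y \<omega>))"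

definition as_le :: "'a measure \<Rightarrow> ('a \<Rightarrow> real) set \<Rightarrow> ('a \<Rightarrow> real) set \<Rightarrow> bool" where
  "as_le Q X Y \<longleftrightarrow> (\<exists>x\<in>X. \<exists>y\<in>Y. AE \<omega> in Q. x \<omega> \<le> y \<omega>)"

definition L0_abs :: "'a measure \<Rightarrow> 'a measure set \<Rightarrow> ('a \<Rightarrow> real) set \<Rightarrow> ('a \<Rightarrow> real) set" where
  "L0_abs M \<P> X = (\<Union>x\<in>X. qs_class M \<P> (\<lambda>\<omega>. \<bar>x \<omega>\<bar>))"

definition Linf :: "'a measure \<Rightarrow> 'a measure set \<Rightarrow> ('a \<Rightarrow> real) set set" where
  "Linf M \<P> = {X \<in> L0 M \<P>. \<exists>m>0. qs_le M \<P> (L0_abs M \<P> X) (qs_class M \<P> (\<lambda>_. m))}"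

text \<open>The map \<open>[x]\<^sub>c \<mapsto> [x]\<^sub>Q\<close>. For \<open>Q\<close> in \<^const>\<open>polar_null_measures\<close> all members of the
  union coincide; see \<open>class_proj_qs_class\<close> below.\<close>

definition class_proj :: "'a measure \<Rightarrow> 'a measure \<Rightarrow> ('a \<Rightarrow> real) set \<Rightarrow> ('a \<Rightarrow> real) set" where
  "class_proj M Q X = (\<Union>x\<in>X. as_eq M Q `` {x})"


section \<open>Market models\<close>

text \<open>A model of dimension \<open>d\<close> is the list of its \<open>d\<close> coordinates \<open>(S\<^sub>0\<^sup>i, S\<^sub>1\<^sup>i)\<close>.
  Dimensions are positive. Coordinates (and strategies) are indexed from \<open>0\<close>.\<close>

type_synonym 'a market = "(real \<times> ('a \<Rightarrow> real)) list"

definition markets :: "'a measure \<Rightarrow> 'a market set" where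
  "markets M = {S. length S \<ge> 1 \<and>
     (\<forall>(s0, s1)\<in>set S. s0 \<ge> 0 \<and> s1 \<in> borel_measurable M \<and>
        (\<forall>\<omega>\<in>space M. s1 \<omega> \<ge> 0) \<and> (\<exists>B. \<forall>\<omega>\<in>space M. \<bar>s1 \<omega>\<bar> \<le> B))}"

definition strategies :: "'a market \<Rightarrow> real list set" where
  "strategies S = {H. length H = length S}"

definition gain :: "real list \<Rightarrow> 'a market \<Rightarrow> 'a \<Rightarrow> real" where
  "gain H S \<omega> = (\<Sum>i<length S. H ! i * (snd (S ! i) \<omega> - fst (S ! i)))"

definition submarket :: "'a measure \<Rightarrow> 'a market \<Rightarrow> 'a market \<Rightarrow> bool" where
  "submarket M S S' \<longleftrightarrow> (\<forall>i<length S. \<exists>j<length S'.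
     fst (S ! i) = fst (S' ! j) \<and> (\<forall>\<omega>\<in>space M. snd (S ! i) \<omega> = snd (S' ! j) \<omega>))"

definition NA_qs :: "'a measure \<Rightarrow> 'a measure set \<Rightarrow> 'a market \<Rightarrow> bool" where
  "NA_qs M \<P> S \<longleftrightarrow> (\<forall>H\<in>strategies S.
     quasi_surely M \<P> (\<lambda>\<omega>. gain H S \<omega> \<ge> 0) \<longrightarrow> quasi_surely M \<P> (\<lambda>\<omega>. gain H S \<omega> = 0))"

definition NA_as :: "'a measure \<Rightarrow> 'a market \<Rightarrow> bool" where
  "NA_as Q S \<longleftrightarrow> (\<forall>H\<in>strategies S.
     (AE \<omega> in Q. gain H S \<omega> \<ge> 0) \<longrightarrow> (AE \<omega> in Q. gain H S \<omega> = 0))"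

definition market_monotone :: "'a measure \<Rightarrow> ('a market \<Rightarrow> 'a measure set) \<Rightarrow> bool" where
  "market_monotone M \<QQ> \<longleftrightarrow>
     (\<forall>S\<in>markets M. \<forall>S'\<in>markets M. submarket M S S' \<longrightarrow> \<QQ> S' \<subseteq> \<QQ> S)"

definition weakly_NA_preserving ::
  "'a measure \<Rightarrow> 'a measure set \<Rightarrow> ('a market \<Rightarrow> 'a measure set) \<Rightarrow> bool" where
  "weakly_NA_preserving M \<P> \<QQ> \<longleftrightarrow>
     (\<forall>S\<in>markets M. NA_qs M \<P> S \<longrightarrow> (\<exists>Q\<in>\<QQ> S. NA_as Q S))"


section \<open>Sensitivity, reduction sets and localizations\<close>

definition level_set ::
  "'a measure \<Rightarrow> 'a measure set \<Rightarrow> (('a \<Rightarrow> real) set \<Rightarrow> ereal) \<Rightarrow> real \<Rightarrow> ('a \<Rightarrow> real) set set" where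
  "level_set M \<P> f r = {X \<in> Linf M \<P>. f X \<le> ereal r}"

definition sensitive ::
  "'a measure \<Rightarrow> 'a measure set \<Rightarrow> (('a \<Rightarrow> real) set \<Rightarrow> ereal) \<Rightarrow> bool" where
  "sensitive M \<P> f \<longleftrightarrow> (\<forall>r. level_set M \<P> f r = {} \<or>
     (\<forall>X\<in>Linf M \<P>. X \<in> level_set M \<P> f r \<longleftrightarrow>
        (\<forall>Q\<in>polar_null_measures M \<P>. class_proj M Q X \<in> class_proj M Q ` level_set M \<P> f r)))"

definition reduction_set ::
  "'a measure \<Rightarrow> 'a measure set \<Rightarrow> (('a \<Rightarrow> real) set \<Rightarrow> ereal) \<Rightarrow> 'a measure set \<Rightarrow> bool" where
  "reduction_set M \<P> f \<Q> \<longleftrightarrow> \<Q> \<noteq> {} \<and> \<Q> \<subseteq> polar_null_measures M \<P> \<and>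
     (\<forall>r. \<forall>X\<in>Linf M \<P>. X \<in> level_set M \<P> f r \<longleftrightarrow>
        (\<forall>Q\<in>\<Q>. class_proj M Q X \<in> class_proj M Q ` level_set M \<P> f r))"

definition localization ::
  "'a measure \<Rightarrow> 'a measure set \<Rightarrow> (('a \<Rightarrow> real) set \<Rightarrow> ereal) \<Rightarrow> 'a measure set \<Rightarrow>
   ('a measure \<Rightarrow> ('a \<Rightarrow> real) set \<Rightarrow> ereal) \<Rightarrow> bool" where
  "localization M \<P> f \<Q> fQ \<longleftrightarrow>
     (\<forall>Q\<in>\<Q>. \<forall>X\<in>Linf M \<P>. \<forall>Y\<in>Linf M \<P>. class_proj M Q X = class_proj M Q Y \<longrightarrow> fQ Q X = fQ Q Y) \<and>
     (\<forall>X\<in>Linf M \<P>. f X = (SUP Q\<in>\<Q>. fQ Q X))"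


section \<open>Superhedging functionals\<close>

definition superhedge ::
  "'a measure \<Rightarrow> 'a measure set \<Rightarrow> 'a market \<Rightarrow> ('a \<Rightarrow> real) set \<Rightarrow> ereal" where
  "superhedge M \<P> S X = Inf {ereal r | r.
     \<exists>H\<in>strategies S. qs_le M \<P> X (qs_class M \<P> (\<lambda>\<omega>. r + gain H S \<omega>))}"

definition superhedge_as ::
  "'a measure \<Rightarrow> 'a measure set \<Rightarrow> 'a market \<Rightarrow> 'a measure \<Rightarrow> ('a \<Rightarrow> real) set \<Rightarrow> ereal" where
  "superhedge_as M \<P> S Q X = Inf {ereal r | r.
     \<exists>H\<in>strategies S. as_le Q X (qs_class M \<P> (\<lambda>\<omega>. r + gain H S \<omega>))}"

definition superhedge_E ::
  "'a measure \<Rightarrow> 'a measure set \<Rightarrow> 'a market \<Rightarrow> 'a measure \<Rightarrow> ('a \<Rightarrow> real) set \<Rightarrow> ereal" where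
  "superhedge_E M \<P> S Q X = Inf {ereal r | r.
     class_proj M Q X \<in> class_proj M Q ` {Y \<in> Linf M \<P>. superhedge M \<P> S Y \<le> ereal r}}"


section \<open>Independence of representatives\<close>

lemma polar_Un:
  assumes "\<P> \<subseteq> prob_measures M" "polar M \<P> A" "polar M \<P> B"
  shows "polar M \<P> (A \<union> B)"
proof -
  have "emeasure P (A \<union> B) = 0" if P: "P \<in> \<P>" for P
  proof -
    have "sets P = sets M" using assms(1) P by (auto simp: prob_measures_def)
    moreover have "emeasure P A \<le> capacity \<P> A" "emeasure P B \<le> capacity \<P> B"
      unfolding capacity_def using P by (auto intro: SUP_upper)
    ultimately have "A \<in> null_sets P" "B \<in> null_sets P"
      using assms(2,3) by (auto simp: polar_def)
    then show ?thesis by (meson null_setsD1 null_sets.Un)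
  qed
  then have "capacity \<P> (A \<union> B) \<le> 0"
    unfolding capacity_def by (intro SUP_least) simp
  then show ?thesis using assms(2,3) by (auto simp: polar_def)
qed

lemma quasi_surely_mono2:
  assumes "\<P> \<subseteq> prob_measures M" "quasi_surely M \<P> \<phi>" "quasi_surely M \<P> \<psi>"
    and "\<And>\<omega>. \<phi> \<omega> \<Longrightarrow> \<psi> \<omega> \<Longrightarrow> \<theta> \<omega>"
  shows "quasi_surely M \<P> \<theta>"
proof -
  obtain A B where "polar M \<P> A" "\<forall>\<omega>\<in>space M - A. \<phi> \<omega>" "polar M \<P> B" "\<forall>\<omega>\<in>space M - B. \<psi> \<omega>"
    using assms(2,3) by (auto simp: quasi_surely_def)
  then show ?thesis
    using polar_Un[OF assms(1)] assms(4) unfolding quasi_surely_def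
    by (intro exI[of _ "A \<union> B"]) auto
qed

lemma quasi_surely_True: "quasi_surely M \<P> (\<lambda>_. True)"
proof -
  have "capacity \<P> {} \<le> 0" unfolding capacity_def by (intro SUP_least) simp
  then have "polar M \<P> {}" by (simp add: polar_def)
  then show ?thesis by (auto simp: quasi_surely_def)
qed

lemma qs_class_self: "x \<in> borel_measurable M \<Longrightarrow> x \<in> qs_class M \<P> x"
  by (simp add: qs_class_def qs_eq_def quasi_surely_True)

lemma equiv_qs_eq:
  assumes "\<P> \<subseteq> prob_measures M"
  shows "equiv (borel_measurable M) (qs_eq M \<P>)"
proof (rule equivI)
  show "qs_eq M \<P> \<subseteq> borel_measurable M \<times> borel_measurable M"
    by (auto simp: qs_eq_def)
  show "refl_on (borel_measurable M) (qs_eq M \<P>)"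
    by (auto simp: refl_on_def qs_eq_def quasi_surely_True)
  show "sym (qs_eq M \<P>)"
    by (auto simp: sym_def qs_eq_def eq_commute)
  show "trans (qs_eq M \<P>)"
  proof (rule transI)
    fix x y z assume "(x, y) \<in> qs_eq M \<P>" "(y, z) \<in> qs_eq M \<P>"
    then show "(x, z) \<in> qs_eq M \<P>"
      using quasi_surely_mono2[OF assms, of "\<lambda>\<omega>. x \<omega> = y \<omega>" "\<lambda>\<omega>. y \<omega> = z \<omega>" "\<lambda>\<omega>. x \<omega> = z \<omega>"]
      by (simp add: qs_eq_def)
  qed
qed

lemma qs_le_class_iff:
  assumes "\<P> \<subseteq> prob_measures M" "x \<in> borel_measurable M" "y \<in> borel_measurable M"
  shows "qs_le M \<P> (qs_class M \<P> x) (qs_class M \<P> y) \<longleftrightarrow> quasi_surely M \<P> (\<lambda>\<omega>. x \<omega> \<le> y \<omega>)"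
proof
  assume "qs_le M \<P> (qs_class M \<P> x) (qs_class M \<P> y)"
  then obtain x' y' where *: "quasi_surely M \<P> (\<lambda>\<omega>. x \<omega> = x' \<omega>)"
    "quasi_surely M \<P> (\<lambda>\<omega>. y \<omega> = y' \<omega>)" "quasi_surely M \<P> (\<lambda>\<omega>. x' \<omega> \<le> y' \<omega>)"
    by (auto simp: qs_le_def qs_class_def qs_eq_def)
  have "quasi_surely M \<P> (\<lambda>\<omega>. x \<omega> \<le> y' \<omega>)"
    by (rule quasi_surely_mono2[OF assms(1) *(1) *(3)]) simp
  then show "quasi_surely M \<P> (\<lambda>\<omega>. x \<omega> \<le> y \<omega>)"
    by (rule quasi_surely_mono2[OF assms(1) _ *(2)]) simp
next
  assume "quasi_surely M \<P> (\<lambda>\<omega>. x \<omega> \<le> y \<omega>)"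
  then show "qs_le M \<P> (qs_class M \<P> x) (qs_class M \<P> y)"
    unfolding qs_le_def using qs_class_self[OF assms(2)] qs_class_self[OF assms(3)] by blast
qed

lemma quasi_surely_imp_AE:
  assumes "Q \<in> polar_null_measures M \<P>" "quasi_surely M \<P> \<phi>"
  shows "AE \<omega> in Q. \<phi> \<omega>"
proof -
  obtain N where N: "polar M \<P> N" "\<forall>\<omega>\<in>space M - N. \<phi> \<omega>"
    using assms(2) by (auto simp: quasi_surely_def)
  have "sets Q = sets M" using assms(1) by (auto simp: polar_null_measures_def prob_measures_def)
  then have "space Q = space M" by (rule sets_eq_imp_space_eq)
  moreover have "N \<in> null_sets Q"
    using N(1) assms(1) \<open>sets Q = sets M\<close> by (auto simp: polar_null_measures_def polar_def)
  ultimately show ?thesis using N(2) by (intro AE_I'[of N]) auto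
qed

lemma class_proj_qs_class:
  assumes "\<P> \<subseteq> prob_measures M" "Q \<in> polar_null_measures M \<P>" "x \<in> borel_measurable M"
  shows "class_proj M Q (qs_class M \<P> x) = as_eq M Q `` {x}"
proof -
  have "x \<in> qs_class M \<P> x"
    using assms(3) by (rule qs_class_self)
  moreover have "as_eq M Q `` {x'} \<subseteq> as_eq M Q `` {x}" if "x' \<in> qs_class M \<P> x" for x'
  proof
    fix y assume y: "y \<in> as_eq M Q `` {x'}"
    have "AE \<omega> in Q. x \<omega> = x' \<omega>"
      using that by (intro quasi_surely_imp_AE[OF assms(2)]) (auto simp: qs_class_def qs_eq_def)
    moreover have "AE \<omega> in Q. x' \<omega> = y \<omega>" using y by (auto simp: as_eq_def)
    ultimately have "AE \<omega> in Q. x \<omega> = y \<omega>" by eventually_elim simp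
    then show "y \<in> as_eq M Q `` {x}" using y assms(3) by (auto simp: as_eq_def)
  qed
  ultimately show ?thesis unfolding class_proj_def by blast
qed

lemma as_le_class_iff:
  assumes "Q \<in> polar_null_measures M \<P>" "x \<in> borel_measurable M" "y \<in> borel_measurable M"
  shows "as_le Q (qs_class M \<P> x) (qs_class M \<P> y) \<longleftrightarrow> (AE \<omega> in Q. x \<omega> \<le> y \<omega>)"
proof
  assume "as_le Q (qs_class M \<P> x) (qs_class M \<P> y)"
  then obtain x' y' where *: "quasi_surely M \<P> (\<lambda>\<omega>. x \<omega> = x' \<omega>)"
    "quasi_surely M \<P> (\<lambda>\<omega>. y \<omega> = y' \<omega>)" "AE \<omega> in Q. x' \<omega> \<le> y' \<omega>"
    by (auto simp: as_le_def qs_class_def qs_eq_def)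
  from quasi_surely_imp_AE[OF assms(1) *(1)] quasi_surely_imp_AE[OF assms(1) *(2)] *(3)
  show "AE \<omega> in Q. x \<omega> \<le> y \<omega>" by eventually_elim simp
next
  assume "AE \<omega> in Q. x \<omega> \<le> y \<omega>"
  then show "as_le Q (qs_class M \<P> x) (qs_class M \<P> y)"
    unfolding as_le_def using qs_class_self[OF assms(2)] qs_class_self[OF assms(3)] by blast
qed

lemma qs_class_in_Linf_iff:
  assumes "\<P> \<subseteq> prob_measures M" "x \<in> borel_measurable M"
  shows "qs_class M \<P> x \<in> Linf M \<P> \<longleftrightarrow> (\<exists>m>0. quasi_surely M \<P> (\<lambda>\<omega>. \<bar>x \<omega>\<bar> \<le> m))"
proof -
  have x: "x \<in> qs_class M \<P> x"
    using assms(2) by (rule qs_class_self)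
  have "qs_class M \<P> (\<lambda>\<omega>. \<bar>x' \<omega>\<bar>) = qs_class M \<P> (\<lambda>\<omega>. \<bar>x \<omega>\<bar>)" if "x' \<in> qs_class M \<P> x" for x'
  proof -
    have "(\<lambda>\<omega>. \<bar>x' \<omega>\<bar>, \<lambda>\<omega>. \<bar>x \<omega>\<bar>) \<in> qs_eq M \<P>"
      using that assms(2) quasi_surely_mono2[OF assms(1) _ quasi_surely_True,
          of "\<lambda>\<omega>. x \<omega> = x' \<omega>" "\<lambda>\<omega>. \<bar>x' \<omega>\<bar> = \<bar>x \<omega>\<bar>"]
      by (simp add: qs_class_def qs_eq_def borel_measurable_abs)
    then show ?thesis
      unfolding qs_class_def by (rule equiv_class_eq[OF equiv_qs_eq[OF assms(1)]])
  qed
  then have "L0_abs M \<P> (qs_class M \<P> x) = qs_class M \<P> (\<lambda>\<omega>. \<bar>x \<omega>\<bar>)"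
    unfolding L0_abs_def using x by blast
  moreover have "qs_class M \<P> x \<in> L0 M \<P>"
    unfolding L0_def qs_class_def using assms(2) by (rule quotientI)
  ultimately show ?thesis
    using assms by (simp add: Linf_def qs_le_class_iff)
qed

end

theory Submission
  imports Defs
begin

text \<open>
  For \<open>Q \<in> \<QQ> S\<close> the inequalities \<open>\<pi>\<^sup>Q(X) \<le> \<pi>\<^sup>Q\<^sub>E(X) \<le> \<pi>(X)\<close> are formal: a quasi-sure
  superhedge is a \<open>Q\<close>-almost sure one, and \<open>\<pi>\<^sup>Q(X)\<close> depends on \<open>X\<close> only through \<open>j\<^sub>Q(X)\<close>.
  Everything therefore follows from one inequality, \<open>\<pi>(X) \<le> sup \<pi>\<^sup>Q(X)\<close> over \<open>Q \<in> \<QQ> S\<close>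
  (lemma \<open>superhedge_le_SUP_superhedge_as\<close>). Sensitivity and the reduction property are
  consequences too: if \<open>j\<^sub>Q(X) = j\<^sub>Q(Y)\<close> with \<open>\<pi>(Y) \<le> r\<close>, then \<open>\<pi>\<^sup>Q(X) = \<pi>\<^sup>Q(Y) \<le> r\<close>, and if
  this is possible for each \<open>Q \<in> \<QQ> S\<close>, then \<open>\<pi>(X) \<le> r\<close>.

  The inequality rests on offering \<open>X\<close> itself as an additional asset. If
  \<open>-\<pi>(-X) < r < \<pi>(X)\<close>, then \<open>r\<close> lies strictly between the sub- and the superhedging price,
  and the market extended by \<open>X\<close> at price \<open>r\<close> still admits no quasi-sure arbitrage
  (\<open>NA_qs_append\<close>). Weak preservation yields a measure \<open>Q\<close> under which the extended market
  is arbitrage-free, monotonicity places \<open>Q\<close> in \<open>\<QQ> S\<close>, and a \<open>Q\<close>-superhedge of \<open>X\<close> for less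
  than \<open>r\<close> would be an arbitrage in the extended market (\<open>NA_as_append_price_le\<close>); hence
  \<open>r \<le> \<pi>\<^sup>Q(X)\<close>. Now let \<open>r\<close> increase to \<open>\<pi>(X)\<close>.

  If there is no such \<open>r\<close>, that is, \<open>\<pi>(X) \<le> -\<pi>(-X)\<close>, any \<open>Q \<in> \<QQ> S\<close> for which \<open>S\<close> is
  arbitrage-free attains the supremum: \<open>\<pi>(X) \<le> -\<pi>(-X) \<le> -\<pi>\<^sup>Q(-X) \<le> \<pi>\<^sup>Q(X)\<close>.
\<close>

section \<open>Gains of combined strategies and of extended markets\<close>

lemma borel_measurable_gain:
  assumes "S \<in> markets M"
  shows "(\<lambda>\<omega>. gain H S \<omega>) \<in> borel_measurable M"
proof -
  have "snd (S ! i) \<in> borel_measurable M" if "i < length S" for i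
    using bspec[OF conjunct2[OF assms[unfolded markets_def mem_Collect_eq]] nth_mem[OF that]]
    by (simp add: case_prod_beta)
  then show ?thesis
    unfolding gain_def by (intro borel_measurable_sum borel_measurable_times
        borel_measurable_diff borel_measurable_const) auto
qed

lemma gain_add:
  assumes "H \<in> strategies S" "K \<in> strategies S"
  shows "gain (map2 (+) H K) S \<omega> = gain H S \<omega> + gain K S \<omega>"
  using assms unfolding gain_def strategies_def
  by (simp add: sum.distrib[symmetric] algebra_simps)

lemma gain_scale:
  assumes "H \<in> strategies S"
  shows "gain (map ((*) c) H) S \<omega> = c * gain H S \<omega>"
  using assms unfolding gain_def strategies_def
  by (simp add: sum_distrib_left mult.assoc)

lemma gain_append:
  assumes "H \<in> strategies S"
  shows "gain (H @ [h]) (S @ [(s0, s1)]) \<omega> = gain H S \<omega> + h * (s1 \<omega> - s0)"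
  using assms unfolding gain_def strategies_def by (simp add: nth_append)

lemma strategies_append_cases:
  assumes "K \<in> strategies (S @ [a])"
  obtains H h where "K = H @ [h]" "H \<in> strategies S"
  using assms by (cases K rule: rev_cases) (auto simp: strategies_def)

lemma zero_strategy:
  "replicate (length S) 0 \<in> strategies S" "gain (replicate (length S) 0) S \<omega> = 0"
  by (simp_all add: strategies_def gain_def)

lemma submarket_append: "submarket M S (S @ S')"
  unfolding submarket_def by (metis length_append nth_append trans_less_add1)


section \<open>Superhedging prices in terms of representatives\<close>

lemma quasi_surely_mono:
  assumes "\<P> \<subseteq> prob_measures M" "quasi_surely M \<P> \<phi>" "\<And>\<omega>. \<phi> \<omega> \<Longrightarrow> \<theta> \<omega>"
  shows "quasi_surely M \<P> \<theta>"
  using quasi_surely_mono2[OF assms(1,2) assms(2)] assms(3) by blast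

lemma superhedge_qs_class:
  assumes "\<P> \<subseteq> prob_measures M" "S \<in> markets M" "x \<in> borel_measurable M"
  shows "superhedge M \<P> S (qs_class M \<P> x) =
    Inf {ereal r | r. \<exists>H\<in>strategies S. quasi_surely M \<P> (\<lambda>\<omega>. x \<omega> \<le> r + gain H S \<omega>)}"
proof -
  have "(\<lambda>\<omega>. r + gain H S \<omega>) \<in> borel_measurable M" for r H
    using borel_measurable_gain[OF assms(2)] by (intro borel_measurable_add borel_measurable_const)
  then show ?thesis
    unfolding superhedge_def by (simp only: qs_le_class_iff[OF assms(1,3)])
qed

lemma superhedge_as_qs_class:
  assumes "Q \<in> polar_null_measures M \<P>" "S \<in> markets M" "x \<in> borel_measurable M"
  shows "superhedge_as M \<P> S Q (qs_class M \<P> x) =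
    Inf {ereal r | r. \<exists>H\<in>strategies S. AE \<omega> in Q. x \<omega> \<le> r + gain H S \<omega>}"
proof -
  have "(\<lambda>\<omega>. r + gain H S \<omega>) \<in> borel_measurable M" for r H
    using borel_measurable_gain[OF assms(2)] by (intro borel_measurable_add borel_measurable_const)
  then show ?thesis
    unfolding superhedge_as_def by (simp only: as_le_class_iff[OF assms(1,3)])
qed

text \<open>Truncating a representative changes it only on a polar event, so that the bound, which
  a traded asset has to satisfy at every point, can be imposed everywhere.\<close>

lemma Linf_bounded_representative:
  assumes "\<P> \<subseteq> prob_measures M" "X \<in> Linf M \<P>"
  obtains x m where "x \<in> borel_measurable M" "X = qs_class M \<P> x" "\<And>\<omega>. \<bar>x \<omega>\<bar> \<le> m"
proof -
  obtain y where y: "y \<in> borel_measurable M" "X = qs_class M \<P> y"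
    using assms(2) by (auto simp: Linf_def L0_def qs_class_def elim: quotientE)
  then obtain m where m: "m > 0" "quasi_surely M \<P> (\<lambda>\<omega>. \<bar>y \<omega>\<bar> \<le> m)"
    using assms by (auto simp: qs_class_in_Linf_iff)
  define x where "x = (\<lambda>\<omega>. max (- m) (min m (y \<omega>)))"
  have x: "x \<in> borel_measurable M" unfolding x_def using y(1) by measurable
  have "quasi_surely M \<P> (\<lambda>\<omega>. y \<omega> = x \<omega>)"
    by (rule quasi_surely_mono[OF assms(1) m(2)]) (auto simp: x_def)
  then have "(y, x) \<in> qs_eq M \<P>" using x y(1) by (simp add: qs_eq_def)
  then have "X = qs_class M \<P> x"
    unfolding y(2) qs_class_def by (rule equiv_class_eq[OF equiv_qs_eq[OF assms(1)]])
  moreover have "\<bar>x \<omega>\<bar> \<le> m" for \<omega> using m(1) by (auto simp: x_def)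
  ultimately show thesis using that x by blast
qed

lemma class_proj_eq_iff:
  assumes "\<P> \<subseteq> prob_measures M" "Q \<in> polar_null_measures M \<P>"
    and "x \<in> borel_measurable M" "y \<in> borel_measurable M"
  shows "class_proj M Q (qs_class M \<P> x) = class_proj M Q (qs_class M \<P> y) \<longleftrightarrow>
    (AE \<omega> in Q. x \<omega> = y \<omega>)"
proof -
  have "as_eq M Q `` {x} = as_eq M Q `` {y} \<longleftrightarrow> (AE \<omega> in Q. x \<omega> = y \<omega>)"
  proof
    assume "as_eq M Q `` {x} = as_eq M Q `` {y}"
    moreover have "y \<in> as_eq M Q `` {y}" using assms(4) by (simp add: as_eq_def)
    ultimately show "AE \<omega> in Q. x \<omega> = y \<omega>" by (auto simp: as_eq_def)
  next
    assume eq: "AE \<omega> in Q. x \<omega> = y \<omega>"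
    have "(AE \<omega> in Q. x \<omega> = z \<omega>) \<longleftrightarrow> (AE \<omega> in Q. y \<omega> = z \<omega>)" for z
    proof
      assume "AE \<omega> in Q. x \<omega> = z \<omega>"
      with eq show "AE \<omega> in Q. y \<omega> = z \<omega>" by eventually_elim simp
    next
      assume "AE \<omega> in Q. y \<omega> = z \<omega>"
      with eq show "AE \<omega> in Q. x \<omega> = z \<omega>" by eventually_elim simp
    qed
    then show "as_eq M Q `` {x} = as_eq M Q `` {y}"
      using assms(3,4) by (auto simp: as_eq_def)
  qed
  then show ?thesis using assms by (simp add: class_proj_qs_class)
qed

lemma superhedge_as_cong:
  assumes "\<P> \<subseteq> prob_measures M" "Q \<in> polar_null_measures M \<P>" "S \<in> markets M"
    and "X \<in> Linf M \<P>" "Y \<in> Linf M \<P>" "class_proj M Q X = class_proj M Q Y"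
  shows "superhedge_as M \<P> S Q X = superhedge_as M \<P> S Q Y"
proof -
  obtain x m where x: "x \<in> borel_measurable M" "X = qs_class M \<P> x" "\<And>\<omega>. \<bar>x \<omega>\<bar> \<le> m"
    by (rule Linf_bounded_representative[OF assms(1,4)]) blast
  obtain y n where y: "y \<in> borel_measurable M" "Y = qs_class M \<P> y" "\<And>\<omega>. \<bar>y \<omega>\<bar> \<le> n"
    by (rule Linf_bounded_representative[OF assms(1,5)]) blast
  have eq: "AE \<omega> in Q. x \<omega> = y \<omega>"
    using assms(6) class_proj_eq_iff[OF assms(1,2) x(1) y(1)] x(2) y(2) by simp
  have "(AE \<omega> in Q. x \<omega> \<le> z \<omega>) \<longleftrightarrow> (AE \<omega> in Q. y \<omega> \<le> z \<omega>)" for z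
  proof
    assume "AE \<omega> in Q. x \<omega> \<le> z \<omega>"
    with eq show "AE \<omega> in Q. y \<omega> \<le> z \<omega>" by eventually_elim simp
  next
    assume "AE \<omega> in Q. y \<omega> \<le> z \<omega>"
    with eq show "AE \<omega> in Q. x \<omega> \<le> z \<omega>" by eventually_elim simp
  qed
  then show ?thesis
    using assms(2,3) x(1,2) y(1,2) by (simp add: superhedge_as_qs_class)
qed


section \<open>The formal inequalities\<close>

lemma superhedge_as_le_superhedge:
  assumes "\<P> \<subseteq> prob_measures M" "Q \<in> polar_null_measures M \<P>" "S \<in> markets M" "X \<in> Linf M \<P>"
  shows "superhedge_as M \<P> S Q X \<le> superhedge M \<P> S X"
proof -
  obtain x m where x: "x \<in> borel_measurable M" "X = qs_class M \<P> x" "\<And>\<omega>. \<bar>x \<omega>\<bar> \<le> m"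
    by (rule Linf_bounded_representative[OF assms(1,4)]) blast
  show ?thesis
    unfolding x(2) superhedge_qs_class[OF assms(1,3) x(1)]
      superhedge_as_qs_class[OF assms(2,3) x(1)]
    by (rule Inf_superset_mono) (use quasi_surely_imp_AE[OF assms(2)] in blast)
qed

lemma superhedge_as_le_of_class_proj_mem:
  assumes "\<P> \<subseteq> prob_measures M" "Q \<in> polar_null_measures M \<P>" "S \<in> markets M" "X \<in> Linf M \<P>"
    and "class_proj M Q X \<in> class_proj M Q ` level_set M \<P> (superhedge M \<P> S) r"
  shows "superhedge_as M \<P> S Q X \<le> ereal r"
proof -
  obtain Y where Y: "Y \<in> Linf M \<P>" "superhedge M \<P> S Y \<le> ereal r"
    "class_proj M Q X = class_proj M Q Y"
    using assms(5) by (auto simp: level_set_def)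
  have "superhedge_as M \<P> S Q X = superhedge_as M \<P> S Q Y"
    by (rule superhedge_as_cong[OF assms(1-4) Y(1,3)])
  also have "\<dots> \<le> superhedge M \<P> S Y"
    by (rule superhedge_as_le_superhedge[OF assms(1-3) Y(1)])
  finally show ?thesis using Y(2) by order
qed

lemma superhedge_as_le_superhedge_E:
  assumes "\<P> \<subseteq> prob_measures M" "Q \<in> polar_null_measures M \<P>" "S \<in> markets M" "X \<in> Linf M \<P>"
  shows "superhedge_as M \<P> S Q X \<le> superhedge_E M \<P> S Q X"
  unfolding superhedge_E_def
  using superhedge_as_le_of_class_proj_mem[OF assms]
  by (intro Inf_greatest) (auto simp: level_set_def)

lemma superhedge_E_le_superhedge:
  assumes "X \<in> Linf M \<P>"
  shows "superhedge_E M \<P> S Q X \<le> superhedge M \<P> S X"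
proof (rule ereal_le_real)
  fix r assume "superhedge M \<P> S X \<le> ereal r"
  then show "superhedge_E M \<P> S Q X \<le> ereal r"
    unfolding superhedge_E_def using assms by (intro Inf_lower) blast
qed


section \<open>Offering the claim as an additional asset\<close>

text \<open>Consider a position with quasi-surely non-negative gain holding \<open>h\<close> units of the additional asset. If
  \<open>h \<noteq> 0\<close>, dividing its \<open>S\<close>-part by \<open>\<bar>h\<bar>\<close> gives a superhedge of the claim at cost \<open>r\<close>
  (for \<open>h < 0\<close>) or of its negative at cost \<open>-r\<close> (for \<open>h > 0\<close>); only positions in \<open>S\<close>
  remain. The shift by \<open>c\<close> leaves all gains unchanged; it serves to make price and payoff
  non-negative.\<close>

lemma NA_qs_append:
  assumes "\<P> \<subseteq> prob_measures M" "NA_qs M \<P> S"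
    and super: "\<And>H. H \<in> strategies S \<Longrightarrow> \<not> quasi_surely M \<P> (\<lambda>\<omega>. x \<omega> \<le> r + gain H S \<omega>)"
    and sub: "\<And>H. H \<in> strategies S \<Longrightarrow> \<not> quasi_surely M \<P> (\<lambda>\<omega>. - x \<omega> \<le> - r + gain H S \<omega>)"
  shows "NA_qs M \<P> (S @ [(r + c, \<lambda>\<omega>. x \<omega> + c)])"
  unfolding NA_qs_def
proof (intro ballI impI)
  fix K assume K: "K \<in> strategies (S @ [(r + c, \<lambda>\<omega>. x \<omega> + c)])"
    and pos: "quasi_surely M \<P> (\<lambda>\<omega>. 0 \<le> gain K (S @ [(r + c, \<lambda>\<omega>. x \<omega> + c)]) \<omega>)"
  obtain H h where Hh: "K = H @ [h]" and H: "H \<in> strategies S"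
    using K by (rule strategies_append_cases)
  have gain: "gain K (S @ [(r + c, \<lambda>\<omega>. x \<omega> + c)]) \<omega> = gain H S \<omega> + h * (x \<omega> - r)" for \<omega>
    unfolding Hh gain_append[OF H] by simp
  let ?K = "map ((*) (1 / \<bar>h\<bar>)) H"
  have K: "?K \<in> strategies S" using H by (simp add: strategies_def)
  have scaled: "gain H S \<omega> = \<bar>h\<bar> * gain ?K S \<omega>" if "h \<noteq> 0" for \<omega>
    unfolding gain_scale[OF H] using that by simp
  have "\<not> 0 < h"
  proof
    assume h: "0 < h"
    have "- x \<omega> \<le> - r + gain ?K S \<omega>" if "0 \<le> gain H S \<omega> + h * (x \<omega> - r)" for \<omega>
    proof -
      have "0 \<le> h * (gain ?K S \<omega> + (x \<omega> - r))"
        unfolding distrib_left using that h scaled[of \<omega>] by simp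
      then show ?thesis using h by (simp add: zero_le_mult_iff)
    qed
    then show False
      using sub[OF K] quasi_surely_mono[OF assms(1) pos] gain by simp
  qed
  moreover have "\<not> h < 0"
  proof
    assume h: "h < 0"
    have "x \<omega> \<le> r + gain ?K S \<omega>" if "0 \<le> gain H S \<omega> + h * (x \<omega> - r)" for \<omega>
    proof -
      have "gain H S \<omega> + h * (x \<omega> - r) = - h * (gain ?K S \<omega> - (x \<omega> - r))"
        using scaled[of \<omega>] h unfolding right_diff_distrib by simp
      with that have "0 \<le> - h * (gain ?K S \<omega> - (x \<omega> - r))" by (simp only:)
      then show ?thesis using h by (simp add: mult_le_0_iff)
    qed
    then show False
      using super[OF K] quasi_surely_mono[OF assms(1) pos] gain by simp
  qed
  ultimately have "h = 0" by simp
  then show "quasi_surely M \<P> (\<lambda>\<omega>. gain K (S @ [(r + c, \<lambda>\<omega>. x \<omega> + c)]) \<omega> = 0)"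
    using pos assms(2) H unfolding gain NA_qs_def by simp
qed

lemma NA_as_no_uniform_gain:
  assumes "prob_space Q" "NA_as Q S" "H \<in> strategies S" "0 < e"
  shows "\<not> (AE \<omega> in Q. e \<le> gain H S \<omega>)"
proof
  assume ge: "AE \<omega> in Q. e \<le> gain H S \<omega>"
  then have "AE \<omega> in Q. 0 \<le> gain H S \<omega>"
    by eventually_elim (use assms(4) in simp)
  then have "AE \<omega> in Q. gain H S \<omega> = 0"
    using assms(2,3) by (auto simp: NA_as_def)
  with ge have "AE \<omega> in Q. False" by eventually_elim (use assms(4) in simp)
  then show False using prob_space.AE_False[OF assms(1)] by simp
qed

text \<open>Selling the claim at \<open>r\<close> and superhedging it at a cost \<open>s < r\<close> locks in \<open>r - s\<close>.\<close>

lemma NA_as_append_price_le: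
  assumes "prob_space Q" "NA_as Q (S @ [(r + c, \<lambda>\<omega>. x \<omega> + c)])"
    and H: "H \<in> strategies S" and hedge: "AE \<omega> in Q. x \<omega> \<le> s + gain H S \<omega>"
  shows "r \<le> s"
proof (rule ccontr)
  assume "\<not> r \<le> s"
  then have "0 < r - s" by simp
  moreover have "H @ [- 1] \<in> strategies (S @ [(r + c, \<lambda>\<omega>. x \<omega> + c)])"
    using H by (simp add: strategies_def)
  moreover have "AE \<omega> in Q. r - s \<le> gain (H @ [- 1]) (S @ [(r + c, \<lambda>\<omega>. x \<omega> + c)]) \<omega>"
    using hedge by eventually_elim (simp add: gain_append[OF H])
  ultimately show False using NA_as_no_uniform_gain[OF assms(1,2)] by blast
qed

text \<open>A superhedge of \<open>x\<close> and one of \<open>-x\<close> together pay at least zero at cost \<open>s + t\<close>, so a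
  negative cost would be a riskless profit.\<close>

lemma NA_as_bid_le_ask:
  assumes "prob_space Q" "NA_as Q S"
    and H: "H \<in> strategies S" "AE \<omega> in Q. x \<omega> \<le> s + gain H S \<omega>"
    and K: "K \<in> strategies S" "AE \<omega> in Q. - x \<omega> \<le> t + gain K S \<omega>"
  shows "- t \<le> s"
proof (rule ccontr)
  assume "\<not> - t \<le> s"
  then have "0 < - (s + t)" by simp
  moreover have "map2 (+) H K \<in> strategies S"
    using H K by (simp add: strategies_def)
  moreover have "AE \<omega> in Q. - (s + t) \<le> gain (map2 (+) H K) S \<omega>"
    using H(2) K(2) by eventually_elim (simp add: gain_add[OF H(1) K(1)])
  ultimately show False using NA_as_no_uniform_gain[OF assms(1,2)] by blast
qed


section \<open>The superhedging price as a supremum over measures\<close>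

lemma superhedge_le_SUP_superhedge_as:
  fixes \<QQ> :: "'a market \<Rightarrow> 'a measure set"
  assumes P: "\<P> \<subseteq> prob_measures M"
    and \<QQ>: "\<And>T. T \<in> markets M \<Longrightarrow> \<QQ> T \<subseteq> polar_null_measures M \<P>"
    and mono: "market_monotone M \<QQ>"
    and preserving: "weakly_NA_preserving M \<P> \<QQ>"
    and S: "S \<in> markets M"
    and NA: "NA_qs M \<P> S"
    and X: "X \<in> Linf M \<P>"
  shows "superhedge M \<P> S X \<le> (SUP Q\<in>\<QQ> S. superhedge_as M \<P> S Q X)"
proof -
  obtain x m where x: "x \<in> borel_measurable M" and X_eq: "X = qs_class M \<P> x"
    and bound: "\<And>\<omega>. \<bar>x \<omega>\<bar> \<le> m"
    by (rule Linf_bounded_representative[OF P X]) blast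
  have prob: "prob_space Q" if "Q \<in> \<QQ> S" for Q
    using that \<QQ>[OF S] by (auto simp: polar_null_measures_def prob_measures_def)
  have as_eq: "superhedge_as M \<P> S Q X =
      Inf {ereal r | r. \<exists>H\<in>strategies S. AE \<omega> in Q. x \<omega> \<le> r + gain H S \<omega>}"
    if "Q \<in> \<QQ> S" for Q
    unfolding X_eq using that \<QQ>[OF S] by (intro superhedge_as_qs_class[OF _ S x]) auto
  define ask where "ask = superhedge M \<P> S X"
  define bid where "bid = - superhedge M \<P> S (qs_class M \<P> (\<lambda>\<omega>. - x \<omega>))"
  have ask_eq: "ask =
      Inf {ereal r | r. \<exists>H\<in>strategies S. quasi_surely M \<P> (\<lambda>\<omega>. x \<omega> \<le> r + gain H S \<omega>)}"
    unfolding ask_def X_eq by (rule superhedge_qs_class[OF P S x])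
  have bid_eq: "bid =
      - Inf {ereal r | r. \<exists>H\<in>strategies S. quasi_surely M \<P> (\<lambda>\<omega>. - x \<omega> \<le> r + gain H S \<omega>)}"
    unfolding bid_def using x by (subst superhedge_qs_class[OF P S]) auto
  have "ask \<le> (SUP Q\<in>\<QQ> S. superhedge_as M \<P> S Q X)"
  proof (cases "bid < ask")
    case True
    show ?thesis
    proof (rule dense_le_bounded[OF True])
      fix w assume w: "bid < w" "w < ask"
      then obtain r where r: "w = ereal r" by (cases w) auto
      have super: "\<not> quasi_surely M \<P> (\<lambda>\<omega>. x \<omega> \<le> r + gain H S \<omega>)"
        if "H \<in> strategies S" for H
      proof
        assume "quasi_surely M \<P> (\<lambda>\<omega>. x \<omega> \<le> r + gain H S \<omega>)"
        then have "ask \<le> ereal r" unfolding ask_eq using that by (intro Inf_lower) blast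
        then show False using w(2) r by simp
      qed
      have bid_ge: "ereal (- t) \<le> bid"
        if "H \<in> strategies S" "quasi_surely M \<P> (\<lambda>\<omega>. - x \<omega> \<le> t + gain H S \<omega>)" for H t
      proof -
        have "- bid \<le> ereal t"
          unfolding bid_eq ereal_uminus_uminus using that by (intro Inf_lower) blast
        then show ?thesis by (metis ereal_uminus_le_reorder uminus_ereal.simps(1))
      qed
      have sub: "\<not> quasi_surely M \<P> (\<lambda>\<omega>. - x \<omega> \<le> - r + gain H S \<omega>)"
        if "H \<in> strategies S" for H
        using bid_ge[OF that, of "- r"] w(1) r by auto
      \<comment> \<open>Holding cash superhedges \<open>-X\<close> at cost \<open>m\<close>, so the bid price is at least \<open>-m\<close> and
        shifting by \<open>m\<close> makes the price of the new asset non-negative.\<close>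
      have "quasi_surely M \<P> (\<lambda>\<omega>. - x \<omega> \<le> m + gain (replicate (length S) 0) S \<omega>)"
        by (rule quasi_surely_mono[OF P quasi_surely_True])
          (use bound in \<open>simp add: zero_strategy abs_le_iff\<close>)
      then have "ereal (- m) \<le> bid" by (rule bid_ge[OF zero_strategy(1)])
      then have "ereal (- m) < ereal r" using w(1) r by order
      then have r_m: "0 \<le> r + m" by simp
      let ?T = "S @ [(r + m, \<lambda>\<omega>. x \<omega> + m)]"
      have "0 \<le> x \<omega> + m \<and> \<bar>x \<omega> + m\<bar> \<le> 2 * m" for \<omega> using bound[of \<omega>] by linarith
      then have T: "?T \<in> markets M"
        using S x r_m abs_le_D1[OF bound] unfolding markets_def by (auto intro!: exI[of _ "2 * m"])
      have "NA_qs M \<P> ?T" by (rule NA_qs_append[OF P NA super sub])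
      then obtain Q where Q: "Q \<in> \<QQ> ?T" "NA_as Q ?T"
        using preserving T by (auto simp: weakly_NA_preserving_def)
      have QS: "Q \<in> \<QQ> S"
        using mono S T submarket_append[of M S] Q(1) unfolding market_monotone_def by blast
      have "ereal r \<le> superhedge_as M \<P> S Q X"
        unfolding as_eq[OF QS]
        using NA_as_append_price_le[OF prob[OF QS] Q(2)] by (intro Inf_greatest) auto
      also have "\<dots> \<le> (SUP Q\<in>\<QQ> S. superhedge_as M \<P> S Q X)" using QS by (rule SUP_upper)
      finally show "w \<le> (SUP Q\<in>\<QQ> S. superhedge_as M \<P> S Q X)" using r by simp
    qed
  next
    case False
    obtain Q where Q: "Q \<in> \<QQ> S" "NA_as Q S"
      using preserving S NA by (auto simp: weakly_NA_preserving_def)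
    have Qc: "Q \<in> polar_null_measures M \<P>" using Q(1) \<QQ>[OF S] by blast
    have "bid \<le> superhedge_as M \<P> S Q X"
      unfolding as_eq[OF Q(1)]
    proof (rule Inf_greatest, clarify)
      fix s H assume H: "H \<in> strategies S" "AE \<omega> in Q. x \<omega> \<le> s + gain H S \<omega>"
      have "ereal (- s) \<le> - bid"
        unfolding bid_eq ereal_uminus_uminus
      proof (rule Inf_greatest, clarify)
        fix t K assume K: "K \<in> strategies S" "quasi_surely M \<P> (\<lambda>\<omega>. - x \<omega> \<le> t + gain K S \<omega>)"
        have "- t \<le> s"
          by (rule NA_as_bid_le_ask[OF prob[OF Q(1)] Q(2) H K(1) quasi_surely_imp_AE[OF Qc K(2)]])
        then show "ereal (- s) \<le> ereal t" by simp
      qed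
      then show "bid \<le> ereal s" by (metis ereal_minus_le_minus uminus_ereal.simps(1))
    qed
    also have "\<dots> \<le> (SUP Q\<in>\<QQ> S. superhedge_as M \<P> S Q X)" using Q(1) by (rule SUP_upper)
    finally show ?thesis using False by order
  qed
  then show ?thesis by (simp only: ask_def)
qed

theorem theorem4p28:
  fixes M :: "'a measure"
    and \<P> :: "'a measure set"
    and \<QQ> :: "'a market \<Rightarrow> 'a measure set"
    and S :: "'a market"
  assumes "\<P> \<noteq> {}"
    and "\<P> \<subseteq> prob_measures M"
    and "\<And>T. T \<in> markets M \<Longrightarrow> \<QQ> T \<subseteq> polar_null_measures M \<P>"
    and "market_monotone M \<QQ>"
    and "weakly_NA_preserving M \<P> \<QQ>"
    and "S \<in> markets M"
    and "NA_qs M \<P> S"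
  shows "sensitive M \<P> (superhedge M \<P> S) \<and>
    reduction_set M \<P> (superhedge M \<P> S) (\<QQ> S) \<and>
    localization M \<P> (superhedge M \<P> S) (\<QQ> S) (superhedge_as M \<P> S) \<and>
    (\<forall>X\<in>Linf M \<P>.
       superhedge M \<P> S X = (SUP Q\<in>\<QQ> S. superhedge_E M \<P> S Q X) \<and>
       (SUP Q\<in>\<QQ> S. superhedge_E M \<P> S Q X) = (SUP Q\<in>\<QQ> S. superhedge_as M \<P> S Q X))"
proof -
  let ?\<pi> = "superhedge M \<P> S" and ?\<pi>Q = "superhedge_as M \<P> S" and ?\<pi>E = "superhedge_E M \<P> S"
  note P = assms(2) and S = assms(6)
  have QS: "\<QQ> S \<subseteq> polar_null_measures M \<P>" by (rule assms(3)[OF S])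
  have nonempty: "\<QQ> S \<noteq> {}" using assms(5,6,7) by (auto simp: weakly_NA_preserving_def)
  have le: "?\<pi> X \<le> (SUP Q\<in>\<QQ> S. ?\<pi>Q Q X)" if "X \<in> Linf M \<P>" for X
    by (rule superhedge_le_SUP_superhedge_as[OF assms(2-7) that])
  have le_E: "(SUP Q\<in>\<QQ> S. ?\<pi>Q Q X) \<le> (SUP Q\<in>\<QQ> S. ?\<pi>E Q X)" if "X \<in> Linf M \<P>" for X
    using QS superhedge_as_le_superhedge_E[OF P _ S that] by (intro SUP_mono) blast
  have E_le: "(SUP Q\<in>\<QQ> S. ?\<pi>E Q X) \<le> ?\<pi> X" if "X \<in> Linf M \<P>" for X
    using superhedge_E_le_superhedge[OF that] by (intro SUP_least)
  have eq: "?\<pi> X = (SUP Q\<in>\<QQ> S. ?\<pi>E Q X)" "(SUP Q\<in>\<QQ> S. ?\<pi>E Q X) = (SUP Q\<in>\<QQ> S. ?\<pi>Q Q X)"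
    if "X \<in> Linf M \<P>" for X
    using le[OF that] le_E[OF that] E_le[OF that] by order+
  have level: "X \<in> level_set M \<P> ?\<pi> r"
    if X: "X \<in> Linf M \<P>"
      and mem: "\<And>Q. Q \<in> \<QQ> S \<Longrightarrow> class_proj M Q X \<in> class_proj M Q ` level_set M \<P> ?\<pi> r" for X r
  proof -
    have "?\<pi>Q Q X \<le> ereal r" if "Q \<in> \<QQ> S" for Q
      by (rule superhedge_as_le_of_class_proj_mem[OF P _ S X mem]) (use that QS in auto)
    then have "(SUP Q\<in>\<QQ> S. ?\<pi>Q Q X) \<le> ereal r" by (rule SUP_least)
    then have "?\<pi> X \<le> ereal r" using le[OF X] by order
    then show ?thesis using X by (simp add: level_set_def)
  qed
  have "sensitive M \<P> ?\<pi>"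
    unfolding sensitive_def
  proof (intro allI disjI2 ballI iffI)
    fix r X
    assume "X \<in> Linf M \<P>" "\<forall>Q\<in>polar_null_measures M \<P>.
      class_proj M Q X \<in> class_proj M Q ` level_set M \<P> ?\<pi> r"
    then show "X \<in> level_set M \<P> ?\<pi> r" using QS by (intro level) auto
  qed auto
  moreover have "reduction_set M \<P> ?\<pi> (\<QQ> S)"
    unfolding reduction_set_def using nonempty QS level by blast
  moreover have "localization M \<P> ?\<pi> (\<QQ> S) ?\<pi>Q"
    unfolding localization_def
    using superhedge_as_cong[OF P _ S] QS eq by (metis (no_types, lifting) subsetD)
  ultimately show ?thesis using eq by blast
qed

end
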